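(* Let $\boldsymbol{\lambda} = \{\lambda_n\}_{n=0}^\infty$ be any increasing sequence of positive numbers with $\lim_{n \to \infty} \lambda_n = \infty$. Then there exists a singular inner function $\theta$ such that $$K_\theta \cap H^2_{\boldsymbol{\lambda}} = \{0\}.$$
   Context: $\mathbb{D} = \{z \in \mathbb{C} : |z|<1\}$ is the unit disk, $\mathbb{T}$ the unit circle, and $H^2$ the Hardy space of $\mathbb{D}$. "Increasing" is understood in the non-strict sense. For a sequence of positive numbers $\boldsymbol{\lambda} = \{\lambda_n\}_{n=0}^\infty$, $H^2_{\boldsymbol{\lambda}}$ denotes the class of functions $f(z) = \sum_{n=0}^\infty f_n z^n$ holomorphic in $\mathbb{D}$ for which $\sum_{n=0}^\infty \lambda_n |f_n|^2 < \infty$. A singular inner function is a function of the form $\theta(z) = \exp\big(-\int_{\mathbb{T}} \frac{\zeta+z}{\zeta-z}\, d\nu(\zeta)\big)$, $z \in \mathbb{D}$, where $\nu$ is a non-zero positive finite Borel measure on $\mathbb{T}$ which is singular with respect to Lebesgue measure. For an inner function $\theta$, the model space is $K_\theta = H^2 \ominus \theta H^2$, the orthogonal complement in $H^2$ of the subspace $\theta H^2 = \{\theta h : h \in H^2\}$. *)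

theory Defs
  imports "HOL-Complex_Analysis.Complex_Analysis"
begin

text \<open>
  A function on the unit disk is represented by its extension by \<open>0\<close> to all of \<open>complex\<close>.
  Equality of such functions is thus equality on the disk, and the zero function of every
  space below is \<open>\<lambda>_. 0\<close>.
\<close>

definition holomorphic_disk :: "(complex \<Rightarrow> complex) set" where
  "holomorphic_disk =
     {f. f holomorphic_on ball 0 1 \<and> (\<forall>z. z \<notin> ball 0 1 \<longrightarrow> f z = 0)}"

definition taylor_coeff :: "(complex \<Rightarrow> complex) \<Rightarrow> nat \<Rightarrow> complex" where
  "taylor_coeff f n = (deriv ^^ n) f 0 / fact n"

definition weighted_hardy :: "(nat \<Rightarrow> real) \<Rightarrow> (complex \<Rightarrow> complex) set" where
  "weighted_hardy lam =
     {f \<in> holomorphic_disk. summable (\<lambda>n. lam n * (cmod (taylor_coeff f n))\<^sup>2)}"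

definition hardy :: "(complex \<Rightarrow> complex) set" where
  "hardy = {f \<in> holomorphic_disk. summable (\<lambda>n. (cmod (taylor_coeff f n))\<^sup>2)}"

text \<open>
  The inner product of the Hardy space; by Parseval it is the inner product of the boundary
  functions in \<open>L\<^sup>2\<close> of normalized arc length. The series converges absolutely for
  \<open>f\<close>, \<open>g\<close> in \<^const>\<open>hardy\<close>.
\<close>

definition hardy_inner :: "(complex \<Rightarrow> complex) \<Rightarrow> (complex \<Rightarrow> complex) \<Rightarrow> complex" where
  "hardy_inner f g = (\<Sum>n. taylor_coeff f n * cnj (taylor_coeff g n))"

definition circle_borel :: "complex measure" where
  "circle_borel = restrict_space borel (sphere 0 1)"

definition circle_lebesgue :: "complex measure" where
  "circle_lebesgue = distr (restrict_space lborel {0..<2 * pi}) circle_borel cis"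

lemma cis_measurable_circle:
  "cis \<in> restrict_space lborel {0..<2 * pi} \<rightarrow>\<^sub>M circle_borel"
  unfolding circle_borel_def
proof (rule measurable_restrict_space2)
  show "cis \<in> space (restrict_space lborel {0..<2 * pi}) \<rightarrow> sphere 0 1"
    by simp
  have "cis \<in> borel_measurable lborel"
    by (auto intro!: borel_measurable_continuous_onI continuous_intros)
  then show "cis \<in> borel_measurable (restrict_space lborel {0..<2 * pi})"
    by (rule measurable_restrict_space1)
qed

lemma emeasure_circle_lebesgue:
  "emeasure circle_lebesgue (sphere 0 1) = ennreal (2 * pi)"
proof -
  have "sphere 0 1 \<in> sets circle_borel"
    by (auto simp: circle_borel_def sets_restrict_space)
  moreover have "cis -` sphere 0 1 = UNIV"
    by auto
  ultimately show ?thesis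
    unfolding circle_lebesgue_def
    by (simp add: emeasure_distr[OF cis_measurable_circle] space_restrict_space
        emeasure_restrict_space)
qed

definition mutually_singular :: "'a measure \<Rightarrow> 'a measure \<Rightarrow> bool" where
  "mutually_singular M N \<longleftrightarrow>
     (\<exists>A. A \<in> sets M \<and> A \<in> sets N \<and> emeasure M A = 0 \<and> emeasure N (space N - A) = 0)"

definition singular_inner_of :: "complex measure \<Rightarrow> complex \<Rightarrow> complex" where
  "singular_inner_of \<nu> z =
     (if z \<in> ball 0 1 then exp (- (LINT \<zeta>|\<nu>. (\<zeta> + z) / (\<zeta> - z))) else 0)"

definition singular_inner_function :: "(complex \<Rightarrow> complex) \<Rightarrow> bool" where
  "singular_inner_function \<theta> \<longleftrightarrow>
     (\<exists>\<nu>. sets \<nu> = sets circle_borel \<and> finite_measure \<nu> \<and> emeasure \<nu> (space \<nu>) \<noteq> 0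
        \<and> mutually_singular \<nu> circle_lebesgue \<and> \<theta> = singular_inner_of \<nu>)"

definition model_space :: "(complex \<Rightarrow> complex) \<Rightarrow> (complex \<Rightarrow> complex) set" where
  "model_space \<theta> =
     {f \<in> hardy. \<forall>g \<in> {\<lambda>z. \<theta> z * h z | h. h \<in> hardy}. hardy_inner f g = 0}"

end

theory Submission
  imports Defs "HOL-Probability.Probability_Measure"
begin

text \<open>
  The weighted space pairs with the space of power series \<open>g\<close> for which
  \<open>\<Sum>n. \<bar>g\<^sub>n\<bar>\<^sup>2 / lam n\<close> is finite. A function in the model space of \<open>\<theta>\<close> is orthogonal to
  every \<open>\<theta> h\<close> with \<open>h\<close> in the Hardy space. If such products \<open>\<theta> h\<close> come close to every
  monomial \<open>z\<^sup>k\<close> in the norm of that larger space, then a function that lies in the weighted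
  space as well is orthogonal to all monomials, and hence is zero. It therefore suffices to find
  a singular \<open>\<nu>\<close> and bounded \<open>h\<^sub>j\<close> with \<open>\<theta> h\<^sub>j \<rightarrow> 1\<close> in that norm.

  If \<open>\<nu>\<close> is approximated by measures \<open>\<sigma>\<^sub>j\<close> with densities at most \<open>2\<^sup>j\<close> with respect to
  normalized arc length, let \<open>h\<^sub>j\<close> be the exponential of the Herglotz integral of \<open>\<sigma>\<^sub>j\<close>. Then
  \<open>\<bar>\<theta> h\<^sub>j\<bar> \<le> \<bar>h\<^sub>j\<bar> \<le> exp (2\<^sup>j)\<close> on the disk, and \<open>\<theta> h\<^sub>j\<close> is near \<open>1\<close> on the disk of
  radius \<open>1/2\<close> as soon as \<open>\<nu>\<close> and \<open>\<sigma>\<^sub>j\<close> are near. The global bound controls the Taylor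
  coefficients of \<open>\<theta> h\<^sub>j - 1\<close> beyond an index \<open>N\<^sub>j\<close> where \<open>lam\<close> is much larger than
  \<open>exp (2\<^sup>j)\<^sup>2\<close>, and the nearness controls the finitely many before it
  (\<open>pairing_bound\<close>). What matters is the order of choices: the growth of \<open>h\<^sub>j\<close> is known
  first, then \<open>N\<^sub>j\<close> is fixed by \<open>lam\<close>, and only then is the distance of \<open>\<nu>\<close> and \<open>\<sigma>\<^sub>j\<close>
  prescribed.

  Such a \<open>\<nu>\<close> is obtained from binary expansions. Let \<open>x\<close> be uniform in the unit interval,
  and replace by \<open>0\<close> its binary digits at a sequence of positions \<open>s\<^sub>0 < s\<^sub>1 < \<dots>\<close>; wrapped
  around the circle, the result has law \<open>\<nu>\<close>. Erasing the first \<open>j\<close> digits only gives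
  \<open>\<sigma>\<^sub>j\<close>. Each erasure at most doubles the density (\<open>nn_integral_erase_digit\<close>), the two
  variables differ by at most \<open>2 / 2 ^ s\<^sub>j\<close> (\<open>erase_all_close\<close>), so that a large
  \<open>s\<^sub>j\<close> provides the required nearness, and \<open>\<nu>\<close> is singular because the numbers whose digits
  vanish at infinitely many prescribed positions form a null set (\<open>null_digits_vanish\<close>,
  \<open>erase_all_digits_vanish\<close>).
\<close>

section \<open>Orthogonality of the characters of the circle\<close>

abbreviation unit_uniform :: "real measure" where
  "unit_uniform \<equiv> restrict_space lborel {0..<1}"

lemma prob_space_unit_uniform: "prob_space unit_uniform"
  by (rule prob_spaceI) (simp add: space_restrict_space emeasure_restrict_space)

lemma integral_cis_unit_uniform:
  fixes k :: int
  shows "(LINT x|unit_uniform. cis (2 * pi * k * x)) = (if k = 0 then 1 else 0)"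
proof (cases "k = 0")
  case True
  interpret prob_space unit_uniform by (rule prob_space_unit_uniform)
  show ?thesis using True prob_space by simp
next
  case False
  define c :: real where "c = 2 * pi * k"
  have c: "c \<noteq> 0" using False by (simp add: c_def)
  have "(LINT x|unit_uniform. cis (c * x)) = (LINT x|lborel. indicator {0..<1} x *\<^sub>R cis (c * x))"
    by (subst integral_restrict_space) auto
  also have "\<dots> = (LINT x|lborel. indicator {0..1} x *\<^sub>R cis (c * x))"
  proof (rule integral_cong_AE)
    have [measurable]: "(\<lambda>x. cis (c * x)) \<in> borel_measurable borel"
      by (intro borel_measurable_continuous_onI continuous_intros)
    show "(\<lambda>x. indicator {0..<1} x *\<^sub>R cis (c * x)) \<in> borel_measurable lborel"
      "(\<lambda>x. indicator {0..1} x *\<^sub>R cis (c * x)) \<in> borel_measurable lborel"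
      by measurable
    show "AE x in lborel. indicator {0..<1} x *\<^sub>R cis (c * x) = indicator {0..1} x *\<^sub>R cis (c * x)"
      using AE_lborel_singleton[of "1::real"] by eventually_elim (auto simp: indicator_def)
  qed
  also have "\<dots> = cis (c * 1) / (\<i> * c) - cis (c * 0) / (\<i> * c)"
  proof (rule integral_FTC_Icc)
    fix x :: real
    show "((\<lambda>x. cis (c * x) / (\<i> * c)) has_vector_derivative cis (c * x)) (at x within {0..1})"
      using c by (auto simp: cis_conv_exp intro!: derivative_eq_intros
            has_vector_derivative_real_field) (simp add: mult_ac)
  qed (auto intro!: continuous_intros)
  also have "cis (c * 1) = 1"
    by (simp add: c_def)
  finally show ?thesis
    using False by (simp add: c_def)
qed

lemma integral_norm_trig_polynomial:
  fixes a :: "nat \<Rightarrow> complex"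
  shows "(LINT x|unit_uniform. (cmod (\<Sum>n<N. a n * cis (2 * pi * x) ^ n))\<^sup>2) = (\<Sum>n<N. (cmod (a n))\<^sup>2)"
proof -
  interpret prob_space unit_uniform by (rule prob_space_unit_uniform)
  have int: "integrable unit_uniform (\<lambda>x. cis (c * x))" for c :: real
    by (rule integrable_const_bound[where B = 1])
      (auto intro!: measurable_restrict_space1 borel_measurable_continuous_onI continuous_intros)
  have eq: "complex_of_real ((cmod (\<Sum>n<N. a n * cis (2 * pi * x) ^ n))\<^sup>2)
      = (\<Sum>n<N. \<Sum>m<N. a n * cnj (a m) * cis (2 * pi * (int n - int m) * x))" for x
  proof -
    have "cis (2 * pi * x) ^ n * cnj (cis (2 * pi * x) ^ m) = cis (2 * pi * (int n - int m) * x)" for n m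
      
      by (simp only: complex_cnj_power cis_cnj Complex.DeMoivre cis_mult)
        (simp add: algebra_simps)
    then have "a n * cis (2 * pi * x) ^ n * (cnj (a m) * cnj (cis (2 * pi * x) ^ m))
        = a n * cnj (a m) * cis (2 * pi * (int n - int m) * x)" for n m
      by (metis mult.assoc mult.left_commute)
    then show ?thesis
      unfolding complex_norm_square cnj_sum sum_product complex_cnj_mult by (simp only:)
  qed
  have "complex_of_real (LINT x|unit_uniform. (cmod (\<Sum>n<N. a n * cis (2 * pi * x) ^ n))\<^sup>2)
      = (LINT x|unit_uniform. complex_of_real ((cmod (\<Sum>n<N. a n * cis (2 * pi * x) ^ n))\<^sup>2))"
    by (rule integral_complex_of_real[symmetric])
  also have "\<dots> = (\<Sum>n<N. \<Sum>m<N. a n * cnj (a m) * (LINT x|unit_uniform. cis (2 * pi * (int n - int m) * x)))"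
    unfolding eq
    by (subst Bochner_Integration.integral_sum, (intro Bochner_Integration.integrable_sum integrable_mult_right int)[1])
      (subst Bochner_Integration.integral_sum, auto intro!: int)
  also have "\<dots> = (\<Sum>n<N. \<Sum>m<N. a n * cnj (a m) * (if int n - int m = 0 then 1 else 0))"
    by (simp only: integral_cis_unit_uniform)
  also have "\<dots> = (\<Sum>n<N. \<Sum>m<N. if m = n then a n * cnj (a n) else 0)"
    by (intro sum.cong) auto
  also have "\<dots> = complex_of_real (\<Sum>n<N. (cmod (a n))\<^sup>2)"
    by (simp add: complex_norm_square del: of_real_power)
  finally show ?thesis
    by (simp only: of_real_eq_iff)
qed

section \<open>Taylor coefficients of bounded holomorphic functions\<close>

lemma taylor_sums:
  assumes "f holomorphic_on ball 0 1" "cmod z < 1"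
  shows "(\<lambda>n. taylor_coeff f n * z ^ n) sums f z"
  using holomorphic_power_series[OF assms(1), of z] assms(2) by (simp add: taylor_coeff_def)

lemma taylor_abs_summable:
  assumes "f holomorphic_on ball 0 1" "0 \<le> r" "r < 1"
  shows "summable (\<lambda>n. cmod (taylor_coeff f n) * r ^ n)"
proof -
  have "summable (\<lambda>n. taylor_coeff f n * of_real ((r + 1) / 2) ^ n)"
    using taylor_sums[OF assms(1), of "of_real ((r + 1) / 2)"] assms by (simp add: sums_iff norm_of_real del: of_real_add of_real_divide)
  from powser_insidea[OF this, of "of_real r"] show ?thesis
    using assms by (simp add: norm_mult norm_power norm_of_real del: of_real_add of_real_divide)
qed

lemma taylor_cong:
  assumes "\<And>z. cmod z < 1 \<Longrightarrow> f z = g z"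
  shows "taylor_coeff f n = taylor_coeff g n"
proof -
  have "(deriv ^^ n) f 0 = (deriv ^^ n) g 0"
    using eventually_nhds_in_open[of "ball 0 1" "0::complex"] assms
    by (intro higher_deriv_cong_ev) (auto elim!: eventually_mono)
  then show ?thesis by (simp add: taylor_coeff_def)
qed

text \<open>
  On the circle of radius \<open>r\<close> the Taylor polynomials converge boundedly to \<open>f\<close>, and the mean
  square of each of them is the sum of its squared coefficients by orthogonality. Dominated
  convergence therefore bounds every partial sum by the mean square of \<open>f\<close>, which is at
  most \<open>M\<^sup>2\<close>.
\<close>

lemma taylor_circle_bessel:
  assumes hol: "f holomorphic_on ball 0 1" and r: "0 \<le> r" "r < 1"
    and bd: "\<And>z. cmod z < 1 \<Longrightarrow> cmod (f z) \<le> M"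
  shows "(\<Sum>n<N. (cmod (taylor_coeff f n) * r ^ n)\<^sup>2) \<le> M\<^sup>2"
proof -
  interpret prob_space unit_uniform by (rule prob_space_unit_uniform)
  define c where "c n = taylor_coeff f n * of_real r ^ n" for n
  define p where "p K x = (\<Sum>n<K. c n * cis (2 * pi * x) ^ n)" for K x
  have nc: "cmod (c n) = cmod (taylor_coeff f n) * r ^ n" for n
    using r by (simp add: c_def norm_mult norm_power)
  have sumc: "summable (\<lambda>n. cmod (c n))"
    using taylor_abs_summable[OF hol r] by (simp add: nc)
  have plim: "(\<lambda>K. p K x) \<longlonglongrightarrow> f (of_real r * cis (2 * pi * x))" for x
    using taylor_sums[OF hol, of "of_real r * cis (2 * pi * x)"] r
    by (simp add: p_def c_def sums_def norm_mult power_mult_distrib mult.assoc)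
  have pbd: "cmod (p K x) \<le> (\<Sum>n. cmod (c n))" for K x
    unfolding p_def
    by (rule order_trans[OF norm_sum], rule order_trans[OF _ sum_le_suminf[OF sumc, of "{..<K}"]])
      (auto simp: norm_mult norm_power)
  have pmeas: "p K \<in> borel_measurable unit_uniform" for K
    unfolding p_def
    by (intro measurable_restrict_space1) 
       (simp, intro borel_measurable_continuous_onI continuous_intros)
  have fmeas: "(\<lambda>x. f (of_real r * cis (2 * pi * x))) \<in> borel_measurable unit_uniform"
    by (rule borel_measurable_LIMSEQ_metric[OF pmeas plim])
  have lim: "(\<lambda>K. LINT x|unit_uniform. (cmod (p K x))\<^sup>2)
      \<longlonglongrightarrow> (LINT x|unit_uniform. (cmod (f (of_real r * cis (2 * pi * x))))\<^sup>2)"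
  proof (rule integral_dominated_convergence[where w = "\<lambda>_. (\<Sum>n. cmod (c n))\<^sup>2"])
    show "AE x in unit_uniform. (\<lambda>K. (cmod (p K x))\<^sup>2) \<longlonglongrightarrow> (cmod (f (of_real r * cis (2 * pi * x))))\<^sup>2"
      by (intro always_eventually allI tendsto_intros plim)
    show "\<And>K. AE x in unit_uniform. norm ((cmod (p K x))\<^sup>2) \<le> (\<Sum>n. cmod (c n))\<^sup>2"
      using pbd by (intro always_eventually allI) (auto intro!: power_mono)
    show "(\<lambda>x. (cmod (f (of_real r * cis (2 * pi * x))))\<^sup>2) \<in> borel_measurable unit_uniform"
      using fmeas by measurable
    show "\<And>K. (\<lambda>x. (cmod (p K x))\<^sup>2) \<in> borel_measurable unit_uniform"
      using pmeas by measurable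
  qed auto
  have "(LINT x|unit_uniform. (cmod (p K x))\<^sup>2) = (\<Sum>n<K. (cmod (c n))\<^sup>2)" for K
    unfolding p_def by (rule integral_norm_trig_polynomial)
  with lim have L: "(\<lambda>K. \<Sum>n<K. (cmod (c n))\<^sup>2)
      \<longlonglongrightarrow> (LINT x|unit_uniform. (cmod (f (of_real r * cis (2 * pi * x))))\<^sup>2)"
    by simp
  have "(\<Sum>n<N. (cmod (c n))\<^sup>2) \<le> (LINT x|unit_uniform. (cmod (f (of_real r * cis (2 * pi * x))))\<^sup>2)"
    by (rule LIMSEQ_le_const[OF L]) (auto intro!: exI[of _ N] sum_mono2)
  also have "\<dots> \<le> (LINT x|unit_uniform. M\<^sup>2)"
    using bd r by (intro integral_mono integrable_const_bound[where B = "M\<^sup>2"] integrable_const)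
      (use fmeas in \<open>auto intro!: power_mono AE_I2 simp: norm_mult\<close>)
  also have "\<dots> = M\<^sup>2" using prob_space by simp
  finally show ?thesis by (simp add: nc)
qed

lemma taylor_bessel:
  assumes hol: "f holomorphic_on ball 0 1"
    and bd: "\<And>z. cmod z < 1 \<Longrightarrow> cmod (f z) \<le> M"
  shows "(\<Sum>n<N. (cmod (taylor_coeff f n))\<^sup>2) \<le> M\<^sup>2"
proof -
  have "((\<lambda>r. \<Sum>n<N. (cmod (taylor_coeff f n) * r ^ n)\<^sup>2)
      \<longlongrightarrow> (\<Sum>n<N. (cmod (taylor_coeff f n) * 1 ^ n)\<^sup>2)) (at_left (1::real))"
    by (intro tendsto_intros)
  moreover have "eventually (\<lambda>r. (\<Sum>n<N. (cmod (taylor_coeff f n) * r ^ n)\<^sup>2) \<le> M\<^sup>2) (at_left (1::real))"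
    using eventually_at_left_real[of 0 "1::real"]
    by (auto elim!: eventually_mono intro!: taylor_circle_bessel[OF hol] bd)
  ultimately show ?thesis
    by (auto dest!: tendsto_upperbound)
qed

text \<open>
  The Hardy space consists of functions extended by zero, so a formula that makes sense beyond
  the disk, such as a monomial, must be cut off before it can belong to it.
\<close>

definition restrict_disk :: "(complex \<Rightarrow> complex) \<Rightarrow> complex \<Rightarrow> complex" where
  "restrict_disk f z = (if z \<in> ball 0 1 then f z else 0)"

lemma bounded_holomorphic_in_hardy:
  assumes hol: "f holomorphic_on ball 0 1"
    and bd: "\<And>z. cmod z < 1 \<Longrightarrow> cmod (f z) \<le> M"
  shows "restrict_disk f \<in> hardy"
proof -
  have "restrict_disk f holomorphic_on ball 0 1"
    using hol by (rule holomorphic_transform) (simp add: restrict_disk_def)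
  moreover have "summable (\<lambda>n. (cmod (taylor_coeff f n))\<^sup>2)"
    using taylor_bessel[OF hol bd] by (intro summableI_nonneg_bounded[where x = "M\<^sup>2"]) auto
  moreover have "taylor_coeff (restrict_disk f) n = taylor_coeff f n" for n
    by (rule taylor_cong) (simp add: restrict_disk_def)
  ultimately show ?thesis
    by (simp add: hardy_def holomorphic_disk_def restrict_disk_def)
qed

lemma taylor_coeff_bound_half:
  assumes hol: "f holomorphic_on ball 0 1"
    and bd: "\<And>z. cmod z \<le> 1/2 \<Longrightarrow> cmod (f z) \<le> e"
  shows "cmod (taylor_coeff f n) \<le> 2 ^ n * e"
proof -
  have "cmod ((deriv ^^ n) f 0) \<le> fact n * e / (1/2) ^ n"
  proof (rule Cauchy_inequality)
    show "f holomorphic_on ball 0 (1/2)" "continuous_on (cball 0 (1/2)) f"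
      using hol by (auto intro: holomorphic_on_subset
          intro!: holomorphic_on_imp_continuous_on[OF holomorphic_on_subset[OF hol]])
  qed (use bd in auto)
  then show ?thesis
    by (simp add: taylor_coeff_def norm_divide field_simps power_divide)
qed

text \<open>
  This turns convergence on a small disk into convergence of pairings, at the price of a crude
  global bound. By the Cauchy-Schwarz inequality the squared pairing is at most the squared
  weighted norm of \<open>f\<close> times \<open>\<Sum>n. \<bar>G\<^sub>n\<bar>\<^sup>2 / lam n\<close>. The terms below \<open>N\<close> are small because Cauchy's estimate on
  the circle of radius \<open>1/2\<close> gives \<open>\<bar>G\<^sub>n\<bar> \<le> 2\<^sup>n e\<close>; those from \<open>N\<close> on are small because
  the weight there is at least \<open>lam N\<close>, while all \<open>\<bar>G\<^sub>n\<bar>\<^sup>2\<close> together sum to at most \<open>M\<^sup>2\<close>.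
\<close>

lemma pairing_bound:
  fixes lam :: "nat \<Rightarrow> real" and f :: "nat \<Rightarrow> complex"
  assumes hol: "G holomorphic_on ball 0 1"
    and bdM: "\<And>z. cmod z < 1 \<Longrightarrow> cmod (G z) \<le> M"
    and bde: "\<And>z. cmod z \<le> 1/2 \<Longrightarrow> cmod (G z) \<le> e"
    and lam: "\<And>n. lam n > 0" "incseq lam"
    and f: "summable (\<lambda>n. lam n * (cmod (f n))\<^sup>2)"
  shows "summable (\<lambda>n. f n * cnj (taylor_coeff G n))"
    and "(cmod (\<Sum>n. f n * cnj (taylor_coeff G n)))\<^sup>2
      \<le> (\<Sum>n. lam n * (cmod (f n))\<^sup>2) * (4 ^ N * e\<^sup>2 / lam 0 + M\<^sup>2 / lam N)"
proof -
  define C where "C = (\<Sum>n. lam n * (cmod (f n))\<^sup>2)"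
  define g where "g = taylor_coeff G"
  have C0: "C \<ge> 0" unfolding C_def using lam(1) by (intro suminf_nonneg f) (simp add: less_imp_le)
  have wsum: "(\<Sum>n<K. (cmod (g n))\<^sup>2 / lam n) \<le> 4 ^ N * e\<^sup>2 / lam 0 + M\<^sup>2 / lam N" for K
  proof -
    have e: "0 \<le> e" using bde[of 0] order_trans[OF norm_ge_zero] by fastforce
    have low: "(\<Sum>n<N. (cmod (g n))\<^sup>2 / lam n) \<le> (\<Sum>n<N. 4 ^ n * e\<^sup>2 / lam 0)"
    proof (rule sum_mono)
      fix n
      have "(cmod (g n))\<^sup>2 \<le> (2 ^ n * e)\<^sup>2"
        unfolding g_def by (intro power_mono taylor_coeff_bound_half[OF hol bde]) auto
      also have "\<dots> = 4 ^ n * e\<^sup>2"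
        by (simp add: power2_eq_square flip: power_mult_distrib)
      finally have "(cmod (g n))\<^sup>2 \<le> 4 ^ n * e\<^sup>2" .
      then show "(cmod (g n))\<^sup>2 / lam n \<le> 4 ^ n * e\<^sup>2 / lam 0"
        using lam(1) incseqD[OF lam(2), of 0 n] by (intro frac_le) auto
    qed
    also have "(\<Sum>n<N. 4 ^ n * e\<^sup>2 / lam 0) = (\<Sum>n<N. 4 ^ n) * e\<^sup>2 / lam 0"
      by (simp add: sum_distrib_right sum_divide_distrib)
    also have "\<dots> \<le> 4 ^ N * e\<^sup>2 / lam 0"
    proof -
      have "3 * (\<Sum>n<N. (4::real) ^ n) \<le> 4 ^ N"
        by (induction N) auto
      moreover have "0 \<le> (\<Sum>n<N. (4::real) ^ n)"
        by (intro sum_nonneg) auto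
      ultimately have "(\<Sum>n<N. (4::real) ^ n) \<le> 4 ^ N"
        by linarith
      then show ?thesis using lam(1)[of 0] by (intro divide_right_mono mult_right_mono) auto
    qed
    finally have low: "(\<Sum>n<N. (cmod (g n))\<^sup>2 / lam n) \<le> 4 ^ N * e\<^sup>2 / lam 0" .
    have "(\<Sum>n\<in>{N..<N+K}. (cmod (g n))\<^sup>2 / lam n) \<le> (\<Sum>n\<in>{N..<N+K}. (cmod (g n))\<^sup>2 / lam N)"
      using lam(1) by (intro sum_mono frac_le) (auto intro: incseqD[OF lam(2)])
    also have "\<dots> = (\<Sum>n\<in>{N..<N+K}. (cmod (g n))\<^sup>2) / lam N"
      by (simp add: sum_divide_distrib)
    also have "\<dots> \<le> (\<Sum>n<N+K. (cmod (g n))\<^sup>2) / lam N"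
      using lam(1)[of N] by (intro divide_right_mono sum_mono2) auto
    also have "\<dots> \<le> M\<^sup>2 / lam N"
      using lam(1)[of N] taylor_bessel[OF hol bdM] by (intro divide_right_mono) (auto simp: g_def)
    finally have high: "(\<Sum>n\<in>{N..<N+K}. (cmod (g n))\<^sup>2 / lam n) \<le> M\<^sup>2 / lam N" .
    have "(\<Sum>n<K. (cmod (g n))\<^sup>2 / lam n) \<le> (\<Sum>n\<in>{..<N} \<union> {N..<N+K}. (cmod (g n))\<^sup>2 / lam n)"
      using lam(1) by (intro sum_mono2) (auto simp: less_imp_le)
    also have "\<dots> = (\<Sum>n<N. (cmod (g n))\<^sup>2 / lam n) + (\<Sum>n\<in>{N..<N+K}. (cmod (g n))\<^sup>2 / lam n)"
      by (intro sum.union_disjoint) auto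
    finally show ?thesis using low high by linarith
  qed
  define R where "R = C * (4 ^ N * e\<^sup>2 / lam 0 + M\<^sup>2 / lam N)"
  have part: "(\<Sum>n<K. cmod (f n * cnj (g n))) \<le> sqrt R" for K
  proof -
    have "(\<Sum>n<K. cmod (f n * cnj (g n)))
        = (\<Sum>n<K. (sqrt (lam n) * cmod (f n)) * (cmod (g n) / sqrt (lam n)))"
      using lam(1) by (intro sum.cong) (auto simp: norm_mult less_imp_neq[THEN not_sym])
    also have "\<dots>\<^sup>2 \<le> (\<Sum>n<K. (sqrt (lam n) * cmod (f n))\<^sup>2) * (\<Sum>n<K. (cmod (g n) / sqrt (lam n))\<^sup>2)"
      by (rule Cauchy_Schwarz_ineq_sum)
    also have "\<dots> = (\<Sum>n<K. lam n * (cmod (f n))\<^sup>2) * (\<Sum>n<K. (cmod (g n))\<^sup>2 / lam n)"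
      using lam(1) by (simp add: power_mult_distrib power_divide less_imp_le)
    also have "\<dots> \<le> R"
      unfolding R_def C_def using lam(1)
      by (intro mult_mono wsum sum_le_suminf f sum_nonneg) (auto simp: less_imp_le C0[unfolded C_def])
    finally show ?thesis by (rule real_le_rsqrt)
  qed
  have abs: "summable (\<lambda>n. cmod (f n * cnj (g n)))"
    using part by (intro summableI_nonneg_bounded) auto
  then show "summable (\<lambda>n. f n * cnj (taylor_coeff G n))"
    unfolding g_def by (rule summable_norm_cancel)
  have "cmod (\<Sum>n. f n * cnj (g n)) \<le> sqrt R"
    using summable_norm[OF abs] suminf_le_const[OF abs part] by linarith
  then have "(cmod (\<Sum>n. f n * cnj (g n)))\<^sup>2 \<le> (sqrt R)\<^sup>2"
    by (intro power_mono) auto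
  also have "\<dots> = R"
    unfolding R_def using C0 lam(1) by (intro real_sqrt_pow2 mult_nonneg_nonneg add_nonneg_nonneg) (auto simp: less_imp_le)
  finally show "(cmod (\<Sum>n. f n * cnj (taylor_coeff G n)))\<^sup>2
      \<le> (\<Sum>n. lam n * (cmod (f n))\<^sup>2) * (4 ^ N * e\<^sup>2 / lam 0 + M\<^sup>2 / lam N)"
    by (simp add: g_def R_def C_def)
qed

section \<open>Erasing one binary digit\<close>

definition digit :: "nat \<Rightarrow> real \<Rightarrow> int" where
  "digit s x = \<lfloor>2 ^ s * x\<rfloor> mod 2"

lemma digit_cases: "digit s x = 0 \<or> digit s x = 1"
  unfolding digit_def by presburger

lemma digit_nonneg: "0 \<le> digit s x" and digit_le_1: "digit s x \<le> 1"
  using digit_cases[of s x] by auto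

lemma floor_scale_div:
  assumes "r \<le> s"
  shows "\<lfloor>2 ^ r * x\<rfloor> = \<lfloor>2 ^ s * x :: real\<rfloor> div 2 ^ (s - r)"
proof -
  have "2 ^ r * x = (2 ^ s * x) / real_of_int (2 ^ (s - r))"
    using assms by (simp add: field_simps flip: power_add)
  then show ?thesis
    by (simp only: floor_divide_real_eq_div[of "2 ^ (s - r)"] zero_le_power zero_le_numeral)
qed

text \<open>
  Halving \<open>\<lfloor>2\<^sup>s x\<rfloor>\<close> forgets exactly the digit at position \<open>s\<close>. So two numbers whose floors
  agree after halving have the same digits at all earlier positions, and the same integer part.
\<close>

lemma floor_eq_if_floor_half_eq:
  fixes x y :: real
  assumes "r < s" "\<lfloor>2 ^ s * x\<rfloor> div 2 = \<lfloor>2 ^ s * y\<rfloor> div 2"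
  shows "\<lfloor>2 ^ r * x\<rfloor> = \<lfloor>2 ^ r * y\<rfloor>"
proof -
  have "\<lfloor>2 ^ r * t\<rfloor> = (\<lfloor>2 ^ s * t\<rfloor> div 2) div 2 ^ (s - Suc r)" for t :: real
  proof -
    have "(2::int) ^ (s - r) = 2 * 2 ^ (s - Suc r)"
      using assms(1) by (simp flip: power_Suc add: Suc_diff_Suc)
    then show ?thesis
      using assms(1) by (simp add: floor_scale_div[of r s] zdiv_zmult2_eq)
  qed
  then show ?thesis using assms(2) by simp
qed

definition erase_digit :: "nat \<Rightarrow> real \<Rightarrow> real" where
  "erase_digit s x = x - digit s x / 2 ^ s"

lemma floor_erase_digit: "\<lfloor>2 ^ s * erase_digit s x\<rfloor> = \<lfloor>2 ^ s * x\<rfloor> - digit s x"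
  by (simp add: erase_digit_def right_diff_distrib)

lemma floor_erase_digit_below:
  assumes "r < s"
  shows "\<lfloor>2 ^ r * erase_digit s x\<rfloor> = \<lfloor>2 ^ r * x\<rfloor>"
  by (rule floor_eq_if_floor_half_eq[OF assms], unfold floor_erase_digit, unfold digit_def)
     presburger

lemma floor_add_digit_below:
  assumes "r < s" "digit s x = 0"
  shows "\<lfloor>2 ^ r * (x + 1 / 2 ^ s)\<rfloor> = \<lfloor>2 ^ r * x\<rfloor>"
proof (rule floor_eq_if_floor_half_eq[OF assms(1)])
  have "\<lfloor>2 ^ s * (x + 1 / 2 ^ s)\<rfloor> = \<lfloor>2 ^ s * x\<rfloor> + 1"
    by (simp add: distrib_left)
  then show "\<lfloor>2 ^ s * (x + 1 / 2 ^ s)\<rfloor> div 2 = \<lfloor>2 ^ s * x\<rfloor> div 2"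
    using assms(2) unfolding digit_def by presburger
qed

lemma digit_add_digit:
  assumes "digit s x = 0"
  shows "digit s (x + 1 / 2 ^ s) = 1"
proof -
  have "\<lfloor>2 ^ s * (x + 1 / 2 ^ s)\<rfloor> = \<lfloor>2 ^ s * x\<rfloor> + 1"
    by (simp add: distrib_left)
  then show ?thesis
    using assms unfolding digit_def by presburger
qed

text \<open>
  With the exponent \<open>0\<close> written out, the lemmas on \<open>\<lfloor>2\<^sup>r x\<rfloor>\<close> for \<open>r < s\<close> show that changing
  a digit after the binary point does not leave the unit interval.
\<close>

lemma mem_unit_iff_floor: "x \<in> {0..<1} \<longleftrightarrow> \<lfloor>2 ^ 0 * x :: real\<rfloor> = 0"
  by (simp add: floor_eq_iff)

lemma digit_measurable [measurable]: "digit s \<in> measurable borel (count_space UNIV)"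
  unfolding digit_def by measurable

lemma erase_digit_measurable [measurable]: "erase_digit s \<in> borel_measurable borel"
  unfolding erase_digit_def by measurable

text \<open>
  Erasing a digit either leaves \<open>x\<close> alone or moves it by \<open>1 / 2\<^sup>s\<close> to the left, so the law of
  the result is at most the sum of the uniform law and a translate of it. Hence its density is
  at most \<open>2\<close>.
\<close>

lemma nn_integral_erase_digit:
  assumes s: "0 < s" and P [measurable]: "P \<in> borel_measurable borel"
  shows "(\<integral>\<^sup>+x. P (erase_digit s x) \<partial>unit_uniform) \<le> 2 * (\<integral>\<^sup>+x. P x \<partial>unit_uniform)"
proof -
  define Q where "Q x = P x * indicator {0..<1} x" for x
  have [measurable]: "Q \<in> borel_measurable borel"
    unfolding Q_def by measurable
  have Q: "(\<integral>\<^sup>+x. P x \<partial>unit_uniform) = (\<integral>\<^sup>+x. Q x \<partial>lborel)"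
    unfolding Q_def by (rule nn_integral_restrict_space) simp
  have "(\<integral>\<^sup>+x. P (erase_digit s x) \<partial>unit_uniform)
      = (\<integral>\<^sup>+x. P (erase_digit s x) * indicator {0..<1} x \<partial>lborel)"
    by (rule nn_integral_restrict_space) simp
  also have "\<dots> \<le> (\<integral>\<^sup>+x. Q x + Q (- (1 / 2 ^ s) + 1 * x) \<partial>lborel)"
  proof (rule nn_integral_mono)
    fix x :: real
    have mem: "erase_digit s x \<in> {0..<1} \<longleftrightarrow> x \<in> {0..<1}"
      using floor_erase_digit_below[OF s, of x] mem_unit_iff_floor[of x] mem_unit_iff_floor[of "erase_digit s x"]
      by simp
    have "P (erase_digit s x) * indicator {0..<1} x = Q (erase_digit s x)"
      using mem by (auto simp: Q_def indicator_def simp del: atLeastLessThan_iff)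
    moreover have "erase_digit s x = x \<or> erase_digit s x = - (1 / 2 ^ s) + 1 * x"
      using digit_cases[of s x] by (auto simp: erase_digit_def)
    ultimately show "P (erase_digit s x) * indicator {0..<1} x \<le> Q x + Q (- (1 / 2 ^ s) + 1 * x)"
      by (elim disjE) (simp_all only: add_increasing2 add_increasing order_refl zero_le)
  qed
  also have "\<dots> = (\<integral>\<^sup>+x. Q x \<partial>lborel) + (\<integral>\<^sup>+x. Q (- (1 / 2 ^ s) + 1 * x) \<partial>lborel)"
    by (rule nn_integral_add) measurable
  also have "(\<integral>\<^sup>+x. Q (- (1 / 2 ^ s) + 1 * x) \<partial>lborel) = (\<integral>\<^sup>+x. Q x \<partial>lborel)"
    by (subst nn_integral_real_affine[where c = 1 and t = "- (1 / 2 ^ s)" and f = Q]) simp_all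
  finally show ?thesis by (simp add: Q mult_2)
qed

section \<open>Erasing the digits at a sequence of positions\<close>

text \<open>
  Position \<open>0\<close> is excluded because the digit there is the parity of the integer part.
\<close>

locale sparse_positions =
  fixes s :: "nat \<Rightarrow> nat"
  assumes strict_mono_s: "strict_mono s" and s_pos: "\<And>i. 0 < s i"
begin

lemma s_less: "i < j \<Longrightarrow> s i < s j"
  using strict_mono_s by (auto simp: strict_mono_less)

lemma s_ge: "s j + i \<le> s (j + i)"
proof (induction i)
  case (Suc i)
  then show ?case using s_less[of "j + i" "j + Suc i"] by simp
qed simp

definition erase_first :: "nat \<Rightarrow> real \<Rightarrow> real" where
  "erase_first j x = x - (\<Sum>i<j. digit (s i) x / 2 ^ s i)"

definition erase_all :: "real \<Rightarrow> real" where
  "erase_all x = x - (\<Sum>i. digit (s i) x / 2 ^ s i)"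

lemma digit_tail_bound: "digit (s (j + i)) x / 2 ^ s (j + i) \<le> (1/2) ^ i * (1 / 2 ^ s j)"
proof -
  have "digit (s (j + i)) x / 2 ^ s (j + i) \<le> 1 / 2 ^ (s j + i)"
    using digit_le_1[of "s (j + i)" x] digit_nonneg[of "s (j + i)" x] s_ge[of j i]
    by (intro frac_le power_increasing) auto
  then show ?thesis by (simp add: power_add power_divide mult.commute)
qed

lemma digits_summable: "summable (\<lambda>i. digit (s i) x / 2 ^ s i)"
proof (rule summable_comparison_test')
  show "summable (\<lambda>i. (1/2) ^ i * (1 / 2 ^ s 0) :: real)"
    by (intro summable_mult2 summable_geometric) simp
  show "norm (digit (s i) x / 2 ^ s i) \<le> (1/2) ^ i * (1 / 2 ^ s 0)" for i
    using digit_tail_bound[of 0 i x] digit_nonneg[of "s i" x] by simp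
qed

lemma erase_all_tail:
  "erase_first j x - erase_all x = (\<Sum>i. digit (s (j + i)) x / 2 ^ s (j + i))"
  using suminf_split_initial_segment[OF digits_summable[of x], of j]
  by (simp add: erase_first_def erase_all_def add.commute)

text \<open>
  The positions not yet treated are at least \<open>s j, s j + 1, \<dots>\<close>, so the digits erased there
  contribute at most a geometric series. The bound depends on \<open>s j\<close> alone, which is why
  \<open>s j\<close> can be chosen after everything that concerns the first \<open>j\<close> erasures.
\<close>

lemma erase_all_close: "\<bar>erase_first j x - erase_all x\<bar> \<le> 2 / 2 ^ s j"
proof -
  have sm: "summable (\<lambda>i. digit (s (j + i)) x / 2 ^ s (j + i))"
    using summable_ignore_initial_segment[OF digits_summable[of x], of j] by (simp add: add.commute)
  have geo: "(\<lambda>i. (1/2) ^ i * (1 / 2 ^ s j)) sums (2 / 2 ^ s j :: real)"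
    using sums_mult2[OF geometric_sums[of "1/2 :: real"], of "1 / 2 ^ s j"] by simp
  have "(\<Sum>i. digit (s (j + i)) x / 2 ^ s (j + i)) \<le> (\<Sum>i. (1/2) ^ i * (1 / 2 ^ s j))"
    by (intro suminf_le digit_tail_bound sm sums_summable[OF geo])
  also have "\<dots> = 2 / 2 ^ s j"
    using geo by (rule sums_unique[symmetric])
  finally show ?thesis
    unfolding erase_all_tail using suminf_nonneg[OF sm] digit_nonneg by simp
qed

text \<open>
  Erasing the last digit before the others gives the same result, because it does not affect the
  digits at earlier positions. In this order each step composes a fixed function with a single
  erasure, to which the doubling of the density applies.
\<close>

lemma erase_first_Suc: "erase_first (Suc j) x = erase_first j (erase_digit (s j) x)"
proof -
  have "digit (s i) (erase_digit (s j) x) = digit (s i) x" if "i < j" for i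
    using floor_erase_digit_below[OF s_less[OF that]] by (simp add: digit_def)
  then show ?thesis
    by (simp add: erase_first_def) (simp add: erase_digit_def)
qed

lemma erase_first_measurable [measurable]: "erase_first j \<in> borel_measurable borel"
  unfolding erase_first_def by measurable

lemma erase_all_measurable [measurable]: "erase_all \<in> borel_measurable borel"
  unfolding erase_all_def by measurable

text \<open>
  Each of the \<open>j\<close> erasures at most doubles the density. The bound is the same for all positions,
  so it is known before they are chosen.
\<close>

lemma nn_integral_erase_first:
  assumes "P \<in> borel_measurable borel"
  shows "(\<integral>\<^sup>+x. P (erase_first j x) \<partial>unit_uniform) \<le> 2 ^ j * (\<integral>\<^sup>+x. P x \<partial>unit_uniform)"
proof (induction j)
  case 0
  show ?case by (simp add: erase_first_def)
next
  case (Suc j)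
  have [measurable]: "P \<in> borel_measurable borel" by fact
  have "(\<integral>\<^sup>+x. P (erase_first (Suc j) x) \<partial>unit_uniform)
      = (\<integral>\<^sup>+x. (\<lambda>y. P (erase_first j y)) (erase_digit (s j) x) \<partial>unit_uniform)"
    by (simp add: erase_first_Suc)
  also have "\<dots> \<le> 2 * (\<integral>\<^sup>+x. P (erase_first j x) \<partial>unit_uniform)"
    by (rule nn_integral_erase_digit[OF s_pos]) measurable
  also have "\<dots> \<le> 2 * (2 ^ j * (\<integral>\<^sup>+x. P x \<partial>unit_uniform))"
    by (intro mult_left_mono Suc.IH) simp
  finally show ?case by (simp add: mult.assoc)
qed

definition digits_vanish :: "nat \<Rightarrow> real set" where
  "digits_vanish j = {x \<in> {0..<1}. \<forall>i<j. digit (s i) x = 0}"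

lemma digits_vanish_sets [measurable]: "digits_vanish j \<in> sets borel"
  unfolding digits_vanish_def by measurable

text \<open>
  Translating the set at stage \<open>Suc j\<close> by \<open>1 / 2 ^ s j\<close> turns the last vanishing
  digit into \<open>1\<close> and keeps the earlier ones. The set and its translate are thus disjoint parts
  of the set at stage \<open>j\<close>, and the measure is at least halved in each step.
\<close>

lemma emeasure_digits_vanish: "2 ^ j * emeasure lborel (digits_vanish j) \<le> 1"
proof (induction j)
  case 0
  have "digits_vanish 0 = {0..<1}" by (auto simp: digits_vanish_def)
  then show ?case by simp
next
  case (Suc j)
  let ?A = "digits_vanish (Suc j)"
  let ?B = "(\<lambda>x. 1 / 2 ^ s j + x) ` ?A"
  have B: "?B = (\<lambda>x. - (1 / 2 ^ s j) + x) -` ?A \<inter> space borel"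
  proof (intro equalityI subsetI)
    fix y assume "y \<in> (\<lambda>x. - (1 / 2 ^ s j) + x) -` ?A \<inter> space borel"
    then show "y \<in> ?B" by (intro image_eqI[where x = "- (1 / 2 ^ s j) + y"]) auto
  qed auto
  have [measurable]: "?B \<in> sets borel"
    unfolding B by (rule measurable_sets[of _ borel borel]) measurable
  have "?B \<subseteq> digits_vanish j"
  proof clarify
    fix x assume x: "x \<in> ?A"
    then have d: "digit (s j) x = 0" by (auto simp: digits_vanish_def)
    have eq: "\<lfloor>2 ^ r * (1 / 2 ^ s j + x)\<rfloor> = \<lfloor>2 ^ r * x\<rfloor>" if "r < s j" for r
      using floor_add_digit_below[OF that d] by (simp only: add.commute)
    have "x \<in> {0..<1}" using x unfolding digits_vanish_def by blast
    then have "1 / 2 ^ s j + x \<in> {0..<1}"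
      unfolding mem_unit_iff_floor eq[OF s_pos] .
    moreover have "digit (s i) (1 / 2 ^ s j + x) = 0" if "i < j" for i
      unfolding digit_def eq[OF s_less[OF that]]
      using x that by (simp add: digits_vanish_def flip: digit_def)
    ultimately show "1 / 2 ^ s j + x \<in> digits_vanish j"
      unfolding digits_vanish_def by blast
  qed
  moreover have "?A \<subseteq> digits_vanish j" by (auto simp: digits_vanish_def)
  moreover have "?A \<inter> ?B = {}"
    using digit_add_digit[of "s j"] by (auto simp: digits_vanish_def add.commute)
  ultimately have "emeasure lborel ?A + emeasure lborel ?B \<le> emeasure lborel (digits_vanish j)"
    by (subst plus_emeasure) (auto intro!: emeasure_mono)
  moreover have "emeasure lborel ?B = emeasure lborel ?A"
  proof -
    have "emeasure lborel ?A = emeasure (distr lborel borel ((+) (- (1 / 2 ^ s j)))) ?A"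
      by (simp only: lborel_distr_plus)
    also have "\<dots> = emeasure lborel ?B"
      unfolding B by (subst emeasure_distr) auto
    finally show ?thesis by simp
  qed
  ultimately have "2 * emeasure lborel ?A \<le> emeasure lborel (digits_vanish j)"
    by (simp add: mult_2)
  then have "2 ^ j * (2 * emeasure lborel ?A) \<le> 2 ^ j * emeasure lborel (digits_vanish j)"
    by (intro mult_left_mono) auto
  also note Suc.IH
  finally show ?case by (simp add: mult_ac)
qed

lemma null_digits_vanish: "emeasure lborel (\<Inter>j. digits_vanish j) = 0"
proof -
  let ?m = "emeasure lborel (\<Inter>j. digits_vanish j)"
  have le: "2 ^ j * ?m \<le> 1" for j
  proof -
    have "?m \<le> emeasure lborel (digits_vanish j)"
      by (intro emeasure_mono) auto
    then have "2 ^ j * ?m \<le> 2 ^ j * emeasure lborel (digits_vanish j)"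
      by (intro mult_left_mono) auto
    with emeasure_digits_vanish[of j] show ?thesis by (rule order_trans[rotated])
  qed
  have "?m \<le> 1" using le[of 0] by simp
  then have fin: "?m = ennreal (measure lborel (\<Inter>j. digits_vanish j))"
    by (intro emeasure_eq_ennreal_measure) (auto simp: top_unique)
  let ?r = "measure lborel (\<Inter>j. digits_vanish j)"
  have "ennreal (2 ^ j * ?r) \<le> ennreal 1" for j
    using le[of j] unfolding fin by (simp add: ennreal_mult flip: ennreal_power)
  then have r: "2 ^ j * ?r \<le> 1" for j by (subst (asm) ennreal_le_iff) auto
  have "?r = 0"
  proof (rule ccontr)
    assume "?r \<noteq> 0"
    then have "?r > 0" by (simp add: zero_less_measure_iff)
    then obtain j where "1 / ?r < 2 ^ j" using real_arch_pow[of 2 "1 / ?r"] by auto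
    with r[of j] \<open>?r > 0\<close> show False by (simp add: field_simps)
  qed
  then show ?thesis by (simp add: fin)
qed

text \<open>
  Each digit is a difference \<open>\<lfloor>2\<^sup>n x\<rfloor> - 2 \<lfloor>2\<^sup>n\<^sup>-\<^sup>1 x\<rfloor>\<close>, so after division by \<open>2\<^sup>n\<close> the sum
  telescopes.
\<close>

lemma sum_digits_telescope:
  "(\<Sum>n\<in>{m<..m+k}. digit n x / 2 ^ n) = \<lfloor>2 ^ (m + k) * x\<rfloor> / 2 ^ (m + k) - \<lfloor>2 ^ m * x\<rfloor> / 2 ^ m"
proof (induction k)
  case 0
  show ?case by simp
next
  case (Suc k)
  have "{m<..m + Suc k} = insert (m + Suc k) {m<..m+k}" by auto
  moreover have "digit (m + Suc k) x = \<lfloor>2 ^ (m + Suc k) * x\<rfloor> - 2 * \<lfloor>2 ^ (m + k) * x\<rfloor>"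
    using floor_scale_div[of "m + k" "m + Suc k" x] minus_mult_div_eq_mod[of "\<lfloor>2 ^ (m + Suc k) * x\<rfloor>" 2]
    by (simp add: digit_def)
  ultimately show ?case
    using Suc.IH by (simp add: diff_divide_distrib)
qed

text \<open>
  Selected digits after position \<open>s j\<close> add up to no more than all of them, that is, to no more
  than the part of \<open>x\<close> after that position. This excludes a borrow from the digits at or before
  \<open>s j\<close> when the selected ones are subtracted.
\<close>

lemma tail_le_frac:
  "(\<Sum>i. digit (s (Suc j + i)) x / 2 ^ s (Suc j + i)) \<le> x - \<lfloor>2 ^ s j * x\<rfloor> / 2 ^ s j"
proof (rule suminf_le_const)
  show "summable (\<lambda>i. digit (s (Suc j + i)) x / 2 ^ s (Suc j + i))"
    using summable_ignore_initial_segment[OF digits_summable[of x], of "Suc j"] by (simp add: add.commute)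
  fix n
  have "(\<Sum>i<n. digit (s (Suc j + i)) x / 2 ^ s (Suc j + i))
      = (\<Sum>p\<in>(\<lambda>i. s (Suc j + i)) ` {..<n}. digit p x / 2 ^ p)"
    using strict_mono_s by (subst sum.reindex) (auto intro!: inj_onI simp: strict_mono_eq)
  also have "\<dots> \<le> (\<Sum>p\<in>{s j<..s j + s (Suc j + n)}. digit p x / 2 ^ p)"
  proof (rule sum_mono2)
    show "(\<lambda>i. s (Suc j + i)) ` {..<n} \<subseteq> {s j<..s j + s (Suc j + n)}"
    proof clarify
      fix i assume "i < n"
      then show "s (Suc j + i) \<in> {s j<..s j + s (Suc j + n)}"
        using s_less[of j "Suc j + i"] s_less[of "Suc j + i" "Suc j + n"] by simp
    qed
  qed (simp_all add: digit_nonneg)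
  also have "\<dots> \<le> x - \<lfloor>2 ^ s j * x\<rfloor> / 2 ^ s j"
  proof -
    have "\<lfloor>2 ^ p * x\<rfloor> / 2 ^ p \<le> x" for p :: nat
      by (simp add: divide_le_eq mult.commute)
    then show ?thesis unfolding sum_digits_telescope by simp
  qed
  finally show "(\<Sum>i<n. digit (s (Suc j + i)) x / 2 ^ s (Suc j + i)) \<le> x - \<lfloor>2 ^ s j * x\<rfloor> / 2 ^ s j" .
qed

text \<open>
  After multiplication by \<open>2 ^ s j\<close>, the erasures before position \<open>s j\<close> subtract
  an even integer \<open>2 q\<close>, the one at \<open>s j\<close> subtracts the digit itself, and the later ones
  subtract at most the fractional part. So the floor becomes the old floor minus its own
  parity, minus \<open>2 q\<close>, which is even.
\<close>

lemma erase_all_digit: "digit (s j) (erase_all x) = 0"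
  and erase_all_nonneg: "0 \<le> x \<Longrightarrow> 0 \<le> erase_all x"
  and erase_all_le: "erase_all x \<le> x"
proof -
  define t where "t = (\<Sum>i. digit (s (Suc j + i)) x / 2 ^ s (Suc j + i))"
  define q where "q = (\<Sum>i<j. digit (s i) x * 2 ^ (s j - s i - 1))"
  have t0: "0 \<le> t"
    unfolding t_def using digit_nonneg summable_ignore_initial_segment[OF digits_summable[of x], of "Suc j"]
    by (intro suminf_nonneg) (auto simp: add.commute)
  have t1: "t \<le> x - \<lfloor>2 ^ s j * x\<rfloor> / 2 ^ s j"
    unfolding t_def by (rule tail_le_frac)
  have E: "erase_all x = erase_first (Suc j) x - t"
    using erase_all_tail[of "Suc j" x] by (simp add: t_def)
  have scaled: "2 ^ s j * (digit (s i) x / 2 ^ s i) = 2 * (digit (s i) x * 2 ^ (s j - s i - 1))" if "i < j" for i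
  proof -
    have "(2::real) ^ s j = 2 * 2 ^ (s j - s i - 1) * 2 ^ s i"
      using s_less[OF that] by (simp flip: power_Suc power_add)
    then show ?thesis by simp
  qed
  have "2 ^ s j * (\<Sum>i<j. digit (s i) x / 2 ^ s i) = 2 * of_int q"
    unfolding q_def of_int_sum sum_distrib_left by (intro sum.cong refl) (simp only: scaled lessThan_iff of_int_mult of_int_power of_int_numeral)
  then have "2 ^ s j * erase_first (Suc j) x = 2 ^ s j * x - digit (s j) x - 2 * of_int q"
    by (simp add: erase_first_def right_diff_distrib distrib_left)
  then have eq: "2 ^ s j * erase_all x = 2 ^ s j * x - digit (s j) x - 2 * of_int q - 2 ^ s j * t"
    by (simp add: E right_diff_distrib)
  have t2: "2 ^ s j * t \<le> 2 ^ s j * x - \<lfloor>2 ^ s j * x\<rfloor>"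
    using t1 by (simp add: field_simps)
  have t3: "0 \<le> 2 ^ s j * t" using t0 by simp
  have "\<lfloor>2 ^ s j * erase_all x\<rfloor> = \<lfloor>2 ^ s j * x\<rfloor> - digit (s j) x - 2 * q"
    unfolding floor_eq_iff eq using t2 t3 by (simp, linarith)
  then show "digit (s j) (erase_all x) = 0"
    unfolding digit_def by presburger
next
  have "summable (\<lambda>i. digit (s i) x / 2 ^ s i)" by (rule digits_summable)
  then show "erase_all x \<le> x"
    using digit_nonneg by (simp add: erase_all_def suminf_nonneg)
next
  assume x: "0 \<le> x"
  have "\<lfloor>2 ^ s 0 * x\<rfloor> \<ge> 0" using x by simp
  moreover have "digit (s 0) x \<le> \<lfloor>2 ^ s 0 * x\<rfloor>"
    using calculation by (simp add: digit_def zmod_le_nonneg_dividend)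
  then have "digit (s 0) x / 2 ^ s 0 \<le> \<lfloor>2 ^ s 0 * x\<rfloor> / (2 ^ s 0 :: real)"
    by (intro divide_right_mono) auto
  then show "0 \<le> erase_all x"
    using erase_all_tail[of "Suc 0" x] tail_le_frac[of 0 x] by (simp add: erase_first_def)
qed

lemma erase_all_digits_vanish:
  assumes "x \<in> {0..<1}"
  shows "erase_all x \<in> (\<Inter>j. digits_vanish j)"
  using assms erase_all_nonneg[of x] erase_all_le[of x]
  by (auto simp: digits_vanish_def erase_all_digit)

end

section \<open>Herglotz integrals\<close>

definition herglotz :: "'a measure \<Rightarrow> ('a \<Rightarrow> complex) \<Rightarrow> complex \<Rightarrow> complex" where
  "herglotz M u z = (LINT x|M. (u x + z) / (u x - z))"

lemma norm_herglotz_kernel: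
  assumes "cmod u = 1" "cmod z < 1"
  shows "cmod ((u + z) / (u - z)) \<le> 2 / (1 - cmod z)"
proof -
  have "cmod (u + z) \<le> 2" using norm_triangle_ineq[of u z] assms by simp
  moreover have "1 - cmod z \<le> cmod (u - z)" using norm_triangle_ineq2[of u z] assms by simp
  ultimately show ?thesis using assms by (simp add: norm_divide frac_le)
qed

lemma Re_herglotz_kernel:
  assumes "cmod u = 1" "cmod z < 1"
  shows "0 \<le> Re ((u + z) / (u - z))"
proof -
  have "Re ((u + z) * cnj (u - z)) = (cmod u)\<^sup>2 - (cmod z)\<^sup>2"
    unfolding cmod_power2 by (simp add: algebra_simps power2_eq_square)
  also have "\<dots> \<ge> 0" using assms by (simp add: power_le_one)
  finally show ?thesis by (simp only: Re_complex_div_ge_0)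
qed

text \<open>
  With \<open>w = cnj u * z\<close> the kernel is \<open>(1 + w) / (1 - w) = 2 / (1 - w) - 1\<close>.
\<close>

lemma herglotz_kernel_sums:
  assumes u: "cmod u = 1" and z: "cmod z < 1"
  shows "(\<lambda>n. (if n = 0 then 1 else 2 * cnj u ^ n) * z ^ n) sums ((u + z) / (u - z))"
proof -
  define w where "w = cnj u * z"
  have w: "cmod w < 1" using u z by (simp add: w_def norm_mult)
  have uu: "u * cnj u = 1" using u by (simp add: complex_norm_square[symmetric])
  have uz: "u \<noteq> z" using u z by auto
  have "w \<noteq> 1" using w by auto
  have "u * w = z" by (simp add: w_def mult.assoc[symmetric] uu)
  then have "u + z = u * (1 + w)" "u - z = u * (1 - w)"
    by (simp_all add: distrib_left right_diff_distrib)
  then have "(u + z) / (u - z) = (1 + w) / (1 - w)"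
    using u by auto
  also have "\<dots> = 2 * (1 / (1 - w)) - 1"
    using \<open>w \<noteq> 1\<close> by (simp add: field_simps)
  finally have eq: "(u + z) / (u - z) = 2 * (1 / (1 - w)) - 1" .
  have "(\<lambda>n. 2 * w ^ n - (if n = 0 then 1 else 0)) sums (2 * (1 / (1 - w)) - 1)"
    using w by (intro sums_diff sums_mult geometric_sums) (use sums_single[of 0 "\<lambda>_. 1::complex"] in auto)
  moreover have "2 * w ^ n - (if n = 0 then 1 else 0) = (if n = 0 then 1 else 2 * cnj u ^ n) * z ^ n" for n
    by (simp add: w_def power_mult_distrib)
  ultimately show ?thesis unfolding eq by simp
qed

locale unimodular_variable = prob_space M for M :: "'a measure" +
  fixes u :: "'a \<Rightarrow> complex"
  assumes u_measurable [measurable]: "u \<in> borel_measurable M"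
    and norm_u: "\<And>x. cmod (u x) = 1"
begin

lemma integrable_kernel: "cmod z < 1 \<Longrightarrow> integrable M (\<lambda>x. (u x + z) / (u x - z))"
  by (rule integrable_const_bound[OF always_eventually]) (auto intro!: norm_herglotz_kernel norm_u)

text \<open>
  The kernel series is dominated by a geometric series, so it may be integrated term by term.
  This gives holomorphy although \<open>u\<close> is merely measurable, and it evaluates the integral
  whenever the moments of \<open>u\<close> are known.
\<close>

lemma herglotz_sums:
  assumes z: "cmod z < 1"
  shows "(\<lambda>n. (if n = 0 then 1 else 2 * (LINT x|M. cnj (u x) ^ n)) * z ^ n) sums herglotz M u z"
proof -
  let ?k = "\<lambda>n x. (if n = 0 then 1 else 2 * cnj (u x) ^ n) * z ^ n"
  have bd: "norm (?k n x) \<le> 2 * cmod z ^ n" for n x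
    by (simp add: norm_mult norm_power norm_u)
  have int: "integrable M (?k n)" for n
  proof (rule integrable_const_bound[where B = "2 * cmod z ^ n"])
    have "cnj \<in> borel_measurable borel"
      by (intro borel_measurable_continuous_onI continuous_intros)
    then have [measurable]: "(\<lambda>x. cnj (u x)) \<in> borel_measurable M"
      by (rule measurable_compose[OF u_measurable])
    show "?k n \<in> borel_measurable M"
      by (cases "n = 0") simp_all
  qed (use bd in \<open>intro always_eventually allI\<close>)
  have geo: "summable (\<lambda>n. 2 * cmod z ^ n)"
    using z by (intro summable_mult summable_geometric) simp
  have "(\<lambda>n. LINT x|M. ?k n x) sums (LINT x|M. (\<Sum>n. ?k n x))"
  proof (rule sums_integral[OF int])
    show "AE x in M. summable (\<lambda>n. norm (?k n x))"
      using bd by (intro always_eventually allI summable_comparison_test'[OF geo]) auto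
    have "(LINT x|M. norm (?k n x)) \<le> 2 * cmod z ^ n" for n
      using integral_mono[OF integrable_norm[OF int] integrable_const bd] prob_space by simp
    then show "summable (\<lambda>n. LINT x|M. norm (?k n x))"
      by (intro summable_comparison_test'[OF geo]) auto
  qed
  moreover have "(\<Sum>n. ?k n x) = (u x + z) / (u x - z)" for x
    using herglotz_kernel_sums[OF norm_u z] by (rule sums_unique[symmetric])
  moreover have "(LINT x|M. ?k n x) = (if n = 0 then 1 else 2 * (LINT x|M. cnj (u x) ^ n)) * z ^ n" for n
    using prob_space by simp
  ultimately show ?thesis unfolding herglotz_def by (simp only:)
qed

lemma herglotz_holomorphic: "herglotz M u holomorphic_on ball 0 1"
  using herglotz_sums by (intro power_series_holomorphic) simp

lemma Re_herglotz_nonneg: "cmod z < 1 \<Longrightarrow> 0 \<le> Re (herglotz M u z)"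
  unfolding herglotz_def
  by (subst integral_Re[symmetric, OF integrable_kernel])
    (auto intro!: Bochner_Integration.integral_nonneg Re_herglotz_kernel norm_u)

lemma nn_integral_Re_kernel:
  assumes z: "cmod z < 1"
  shows "(\<integral>\<^sup>+x. ennreal (Re ((u x + z) / (u x - z))) \<partial>M) = ennreal (Re (herglotz M u z))"
proof -
  have "(\<integral>\<^sup>+x. ennreal (Re ((u x + z) / (u x - z))) \<partial>M)
      = ennreal (LINT x|M. Re ((u x + z) / (u x - z)))"
    using z by (intro nn_integral_eq_integral integrable_Re integrable_kernel)
      (auto intro!: Re_herglotz_kernel norm_u)
  then show ?thesis
    unfolding herglotz_def by (simp only: integral_Re[OF integrable_kernel[OF z]])
qed

end

lemma norm_cis_diff: "cmod (cis a - cis b) \<le> \<bar>a - b\<bar>"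
proof -
  have "cis a - cis b = cis b * (exp (\<i> * of_real (a - b)) - 1)"
    unfolding cis_conv_exp[symmetric] by (simp add: right_diff_distrib cis_mult)
  then have "cmod (cis a - cis b) = 2 * \<bar>sin ((a - b) / 2)\<bar>"
    by (simp only: norm_mult norm_cis dist_exp_i_1)
  also have "\<dots> \<le> \<bar>a - b\<bar>"
    using abs_sin_x_le_abs_x[of "(a - b) / 2"] by simp
  finally show ?thesis .
qed

lemma herglotz_kernel_lipschitz:
  assumes "cmod u = 1" "cmod v = 1" "cmod z \<le> 1/2"
  shows "cmod ((u + z) / (u - z) - (v + z) / (v - z)) \<le> 4 * cmod (u - v)"
proof -
  have u: "1/2 \<le> cmod (u - z)" and v: "1/2 \<le> cmod (v - z)"
    using norm_triangle_ineq2[of u z] norm_triangle_ineq2[of v z] assms by auto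
  then have nz: "u \<noteq> z" "v \<noteq> z" by auto
  have "(u + z) / (u - z) - (v + z) / (v - z) = 2 * z * (v - u) / ((u - z) * (v - z))"
    using nz by (simp add: field_simps)
  then have "cmod ((u + z) / (u - z) - (v + z) / (v - z))
      = 2 * cmod z * cmod (u - v) / (cmod (u - z) * cmod (v - z))"
    by (simp add: norm_divide norm_mult norm_minus_commute)
  also have "\<dots> \<le> 1 * cmod (u - v) / (1/2 * (1/2))"
    using assms u v by (intro frac_le mult_mono mult_right_mono) auto
  finally show ?thesis by simp
qed

lemma unimodular_variable_cis:
  assumes "T \<in> borel_measurable borel"
  shows "unimodular_variable unit_uniform (\<lambda>x. cis (2 * pi * T x))"
proof -
  interpret prob_space unit_uniform by (rule prob_space_unit_uniform)
  have [measurable]: "T \<in> borel_measurable borel" by fact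
  have [measurable]: "cis \<in> borel_measurable borel"
    by (intro borel_measurable_continuous_onI continuous_intros)
  show ?thesis
    by unfold_locales (auto intro!: measurable_restrict_space1)
qed

lemma herglotz_uniform:
  assumes "cmod z < 1"
  shows "herglotz unit_uniform (\<lambda>x. cis (2 * pi * x)) z = 1"
proof -
  interpret unimodular_variable unit_uniform "\<lambda>x. cis (2 * pi * x)"
    by (rule unimodular_variable_cis) simp
  have "(LINT x|unit_uniform. cnj (cis (2 * pi * x)) ^ n) = 0" if "n \<noteq> 0" for n
  proof -
    have "cnj (cis (2 * pi * x)) ^ n = cis (2 * pi * (- int n) * x)" for x
      by (simp only: cis_cnj Complex.DeMoivre) (simp add: algebra_simps)
    then show ?thesis
      using integral_cis_unit_uniform[of "- int n"] that by simp
  qed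
  then have "(\<lambda>n. (if n = 0 then 1 else 2 * (LINT x|unit_uniform. cnj (cis (2 * pi * x)) ^ n)) * z ^ n)
      = (\<lambda>n. if n = 0 then 1 else 0)"
    by auto
  then have "(\<lambda>n. if n = 0 then 1 else 0) sums herglotz unit_uniform (\<lambda>x. cis (2 * pi * x)) z"
    using herglotz_sums[OF assms] by simp
  then show ?thesis
    using sums_single[of 0 "\<lambda>_. 1 :: complex"] by (simp add: sums_unique2)
qed

section \<open>A Borel inverse of the parametrization of the circle\<close>

text \<open>
  The argument in \<open>[0, 2 * pi)\<close> divided by \<open>2 * pi\<close>, for \<open>\<zeta>\<close> on the unit circle. It is
  written with \<^const>\<open>arccos\<close>, whose continuity makes it evidently a Borel function; the
  clipping to \<open>[-1, 1]\<close> only serves to extend it to the whole plane.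
\<close>

definition turn :: "complex \<Rightarrow> real" where
  "turn \<zeta> = (let a = arccos (max (- 1) (min 1 (Re \<zeta>))) in if 0 \<le> Im \<zeta> then a else 2 * pi - a) / (2 * pi)"

lemma turn_measurable [measurable]: "turn \<in> borel_measurable borel"
proof -
  have [measurable]: "(\<lambda>\<zeta>. arccos (max (- 1) (min 1 (Re \<zeta>)))) \<in> borel_measurable borel"
    by (intro borel_measurable_continuous_onI continuous_intros) auto
  show ?thesis unfolding turn_def Let_def by measurable
qed

lemma turn_cis:
  assumes "t \<in> {0..<1}"
  shows "turn (cis (2 * pi * t)) = t"
proof (cases "t \<le> 1/2")
  case True
  then have r: "0 \<le> 2 * pi * t" "2 * pi * t \<le> pi" using assms by auto
  then show ?thesis
    using sin_ge_zero[OF r] by (simp add: turn_def arccos_cos)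
next
  case False
  have "sin (2 * pi * t - pi) > 0"
    using assms False by (intro sin_gt_zero) (auto simp: field_simps)
  then have s: "sin (2 * pi * t) < 0" by (simp add: sin_diff)
  have "arccos (cos (2 * pi - 2 * pi * t)) = 2 * pi - 2 * pi * t"
    using assms False by (intro arccos_cos) (auto simp: field_simps)
  moreover have "cos (2 * pi - 2 * pi * t) = cos (2 * pi * t)"
    by (simp add: cos_diff)
  ultimately show ?thesis using s by (simp add: turn_def)
qed

lemma norm_exp_diff_1: "cmod (exp w - 1) \<le> exp (cmod w) * cmod w"
proof -
  have "cmod (exp w - 1) \<le> exp \<bar>Re w\<bar> * cmod w"
    using Taylor_exp[of w 0] by simp
  also have "\<dots> \<le> exp (cmod w) * cmod w"
    using abs_Re_le_cmod[of w] by (intro mult_right_mono) auto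
  finally show ?thesis .
qed

section \<open>The singular inner function of the erased digits\<close>

context sparse_positions
begin

definition limit_exponent :: "complex \<Rightarrow> complex" where
  "limit_exponent = herglotz unit_uniform (\<lambda>x. cis (2 * pi * erase_all x))"

definition approx_exponent :: "nat \<Rightarrow> complex \<Rightarrow> complex" where
  "approx_exponent j = herglotz unit_uniform (\<lambda>x. cis (2 * pi * erase_first j x))"

sublocale lim: unimodular_variable unit_uniform "\<lambda>x. cis (2 * pi * erase_all x)"
  by (rule unimodular_variable_cis) measurable

sublocale approx: unimodular_variable unit_uniform "\<lambda>x. cis (2 * pi * erase_first j x)" for j
  by (rule unimodular_variable_cis) measurable

text \<open>
  The real part is the Poisson integral of a law of density at most \<open>2\<^sup>j\<close>, and the Poisson
  integral of the uniform law is \<open>1\<close>.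
\<close>

lemma Re_approx_exponent_le:
  assumes z: "cmod z < 1"
  shows "Re (approx_exponent j z) \<le> 2 ^ j"
proof -
  define P where "P x = ennreal (Re ((cis (2 * pi * x) + z) / (cis (2 * pi * x) - z)))" for x
  have [measurable]: "cis \<in> borel_measurable borel"
    by (intro borel_measurable_continuous_onI continuous_intros)
  have P: "P \<in> borel_measurable borel" unfolding P_def by measurable
  interpret uni: unimodular_variable unit_uniform "\<lambda>x. cis (2 * pi * x)"
    by (rule unimodular_variable_cis) simp
  have "ennreal (Re (approx_exponent j z)) = (\<integral>\<^sup>+x. P (erase_first j x) \<partial>unit_uniform)"
    unfolding approx_exponent_def P_def by (rule approx.nn_integral_Re_kernel[OF z, symmetric])
  also have "\<dots> \<le> 2 ^ j * (\<integral>\<^sup>+x. P x \<partial>unit_uniform)"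
    by (rule nn_integral_erase_first[OF P])
  also have "(\<integral>\<^sup>+x. P x \<partial>unit_uniform) = 1"
    unfolding P_def uni.nn_integral_Re_kernel[OF z] herglotz_uniform[OF z] by simp
  finally have "ennreal (Re (approx_exponent j z)) \<le> ennreal (2 ^ j)"
    by (simp flip: ennreal_power)
  then show ?thesis by (subst (asm) ennreal_le_iff) auto
qed

lemma exponents_close:
  assumes z: "cmod z \<le> 1/2"
  shows "cmod (approx_exponent j z - limit_exponent z) \<le> 16 * pi / 2 ^ s j"
proof -
  have z1: "cmod z < 1" using z by simp
  let ?K = "\<lambda>t. (cis (2 * pi * t) + z) / (cis (2 * pi * t) - z)"
  have "cmod (?K (erase_first j x) - ?K (erase_all x)) \<le> 16 * pi / 2 ^ s j" for x
  proof -
    have "cmod (?K (erase_first j x) - ?K (erase_all x))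
        \<le> 4 * cmod (cis (2 * pi * erase_first j x) - cis (2 * pi * erase_all x))"
      using z by (intro herglotz_kernel_lipschitz) auto
    also have "\<dots> \<le> 4 * \<bar>2 * pi * erase_first j x - 2 * pi * erase_all x\<bar>"
      by (intro mult_left_mono norm_cis_diff) simp
    also have "\<dots> = 4 * (2 * pi * \<bar>erase_first j x - erase_all x\<bar>)"
      by (simp add: abs_mult flip: right_diff_distrib)
    also have "\<dots> \<le> 4 * (2 * pi * (2 / 2 ^ s j))"
      by (intro mult_left_mono erase_all_close) auto
    finally show ?thesis by simp
  qed
  then have "cmod (LINT x|unit_uniform. ?K (erase_first j x) - ?K (erase_all x))
      \<le> (LINT x|unit_uniform. 16 * pi / 2 ^ s j)"
    by (intro Bochner_Integration.integral_norm_bound_integral Bochner_Integration.integrable_diff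
        approx.integrable_kernel lim.integrable_kernel z1 lim.integrable_const)
  also have "\<dots> = 16 * pi / 2 ^ s j" using lim.prob_space by simp
  also have "(LINT x|unit_uniform. ?K (erase_first j x) - ?K (erase_all x))
      = approx_exponent j z - limit_exponent z"
    unfolding approx_exponent_def limit_exponent_def herglotz_def
    by (intro Bochner_Integration.integral_diff approx.integrable_kernel lim.integrable_kernel z1)
  finally show ?thesis .
qed

definition erased_measure :: "complex measure" where
  "erased_measure = distr unit_uniform circle_borel (\<lambda>x. cis (2 * pi * erase_all x))"

lemma erased_cis_measurable:
  "(\<lambda>x. cis (2 * pi * erase_all x)) \<in> measurable unit_uniform circle_borel"
  unfolding circle_borel_def by (rule measurable_restrict_space2) auto

lemma singular_inner_of_erased_measure:
  assumes "cmod z < 1"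
  shows "singular_inner_of erased_measure z = exp (- limit_exponent z)"
proof -
  have [measurable]: "(\<lambda>\<zeta>. (\<zeta> + z) / (\<zeta> - z)) \<in> borel_measurable circle_borel"
    unfolding circle_borel_def by (rule measurable_restrict_space1) measurable
  have "(LINT \<zeta>|erased_measure. (\<zeta> + z) / (\<zeta> - z)) = limit_exponent z"
    unfolding erased_measure_def limit_exponent_def herglotz_def
    by (rule integral_distr[OF erased_cis_measurable]) measurable
  then show ?thesis using assms by (simp add: singular_inner_of_def)
qed

text \<open>
  The measure lives on the points whose turn has vanishing digits at all positions \<open>s j\<close>, and
  these turns form a Lebesgue null set.
\<close>

lemma erased_measure_singular: "mutually_singular erased_measure circle_lebesgue"
proof -
  let ?D = "\<Inter>j. digits_vanish j"
  let ?A = "{\<zeta> \<in> sphere 0 1. turn \<zeta> \<notin> ?D}"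
  have [measurable]: "?D \<in> sets borel" by measurable
  have "turn -` (- ?D) \<inter> space borel \<in> sets borel"
    by (rule measurable_sets[OF turn_measurable]) measurable
  then have A: "?A \<in> sets circle_borel"
    unfolding circle_borel_def sets_restrict_space by (intro image_eqI[of _ _ "turn -` (- ?D) \<inter> space borel"]) auto
  have sp: "space circle_borel = sphere 0 1"
    by (simp add: circle_borel_def space_restrict_space)
  have mem01: "x \<in> {0..<1}" if "x \<in> ?D" for x
    using that by (auto simp: digits_vanish_def)
  have "(\<lambda>x. cis (2 * pi * erase_all x)) -` ?A \<inter> space unit_uniform = {}"
    using erase_all_digits_vanish mem01 turn_cis by (fastforce simp: space_restrict_space)
  then have 1: "emeasure erased_measure ?A = 0"
    unfolding erased_measure_def using A by (subst emeasure_distr[OF erased_cis_measurable]) auto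
  have sub: "cis -` (sphere 0 1 - ?A) \<inter> {0..<2*pi} \<subseteq> (*) (1 / (2 * pi)) -` ?D"
  proof
    fix t assume t: "t \<in> cis -` (sphere 0 1 - ?A) \<inter> {0..<2*pi}"
    then have "turn (cis t) \<in> ?D" by simp
    moreover have "turn (cis t) = 1 / (2 * pi) * t"
      using turn_cis[of "t / (2 * pi)"] t by simp
    ultimately show "t \<in> (*) (1 / (2 * pi)) -` ?D" by simp
  qed
  have "emeasure circle_lebesgue (space circle_borel - ?A)
      = emeasure (restrict_space lborel {0..<2*pi}) (cis -` (sphere 0 1 - ?A) \<inter> {0..<2*pi})"
    unfolding circle_lebesgue_def using A sp
    by (subst emeasure_distr[OF cis_measurable_circle])
      (auto simp: space_restrict_space intro: sets.compl_sets[of _ circle_borel, unfolded sp])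
  also have "\<dots> = emeasure lborel (cis -` (sphere 0 1 - ?A) \<inter> {0..<2*pi})"
    by (rule emeasure_restrict_space) auto
  also have "\<dots> \<le> emeasure lborel ((*) (1 / (2 * pi)) -` ?D \<inter> space lborel)"
  proof (rule emeasure_mono)
    have "(*) (1 / (2 * pi)) -` ?D \<inter> space borel \<in> sets borel"
      by (rule measurable_sets[of _ borel borel]) measurable
    then show "(*) (1 / (2 * pi)) -` ?D \<inter> space lborel \<in> sets lborel" by simp
  qed (use sub in auto)
  also have "\<dots> = emeasure (distr lborel borel ((*) (1 / (2 * pi)))) ?D"
    by (subst emeasure_distr) auto
  also have "\<dots> = 0"
    by (subst lborel_distr_mult) (auto simp: emeasure_density nn_integral_cmult null_digits_vanish)
  finally have 2: "emeasure circle_lebesgue (space circle_lebesgue - ?A) = 0"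
    by (simp add: circle_lebesgue_def)
  show ?thesis
    unfolding mutually_singular_def using A 1 2
    by (intro exI[of _ ?A]) (simp add: erased_measure_def circle_lebesgue_def)
qed

lemma singular_inner_function_erased:
  "singular_inner_function (singular_inner_of erased_measure)"
proof -
  interpret prob_space erased_measure
    unfolding erased_measure_def by (intro lim.prob_space_distr erased_cis_measurable)
  show ?thesis
    unfolding singular_inner_function_def
    using erased_measure_singular emeasure_space_1 finite_measure_axioms
    by (intro exI[of _ erased_measure]) (auto simp: erased_measure_def)
qed

end

section \<open>Trivial intersection with the weighted space\<close>

lemma taylor_coeff_power: "taylor_coeff (\<lambda>z. z ^ k) n = (if n = k then 1 else 0)"
  using higher_deriv_power[of n 0 k 0]
  by (cases n k rule: linorder_cases)
    (auto simp: taylor_coeff_def pochhammer_0_left pochhammer_fact[symmetric] Suc_diff_le simp del: power_0_left)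

lemma taylor_coeff_add:
  assumes "f holomorphic_on ball 0 1" "g holomorphic_on ball 0 1"
  shows "taylor_coeff (\<lambda>z. f z + g z) n = taylor_coeff f n + taylor_coeff g n"
  using higher_deriv_add[OF assms, of 0 n] by (simp add: taylor_coeff_def add_divide_distrib)

lemma eq_zero_if_taylor_zero:
  assumes "f \<in> holomorphic_disk" "\<And>n. taylor_coeff f n = 0"
  shows "f = (\<lambda>_. 0)"
proof
  fix z show "f z = 0"
    using assms taylor_sums[of f z] sums_unique2[OF sums_zero, of "f z"]
    by (cases "cmod z < 1") (auto simp: holomorphic_disk_def)
qed

theorem theorem1p4:
  fixes lam :: "nat \<Rightarrow> real"
  assumes "\<And>n. lam n > 0"
    and "incseq lam"
    and "filterlim lam at_top sequentially"
  shows "\<exists>\<theta>. singular_inner_function \<theta> \<and> model_space \<theta> \<inter> weighted_hardy lam = {\<lambda>_. 0}"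
proof -
  \<comment> \<open>\<open>M j\<close> depends on \<open>j\<close> only, so \<open>N j\<close> and then \<open>s j\<close> may be chosen in terms of it. The sum over
    \<open>N i\<close> makes \<open>s\<close> strictly increasing with \<open>N j + j \<le> s j\<close>.\<close>
  define M :: "nat \<Rightarrow> real" where "M j = exp (2 ^ j) + 1" for j
  have "\<exists>N. (M j)\<^sup>2 * Suc j \<le> lam N" for j
    using eventually_happens[OF filterlim_at_top[THEN iffD1, OF assms(3), rule_format]] by auto
  then obtain N where N: "(M j)\<^sup>2 * Suc j \<le> lam (N j)" for j by metis
  define s where "s j = Suc j + (\<Sum>i\<le>j. N i)" for j
  interpret sparse_positions s
    by unfold_locales (auto simp: s_def strict_mono_Suc_iff)
  define \<theta> where "\<theta> = singular_inner_of erased_measure"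
  \<comment> \<open>On the disk of radius \<open>1/2\<close> the two exponents differ by at most \<open>16 * pi\<close> for every \<open>j\<close>;
    this is where the constant \<open>exp (16 * pi)\<close> comes from.\<close>
  define B where "B = exp (16 * pi) * (16 * pi)"
  define e where "e j = B / 2 ^ s j" for j
  define G where "G j k z = z ^ k * (exp (approx_exponent j z - limit_exponent z) - 1)" for j k z
  have hol_exp: "approx_exponent j holomorphic_on ball 0 1" "limit_exponent holomorphic_on ball 0 1" for j
    unfolding approx_exponent_def limit_exponent_def
    by (rule approx.herglotz_holomorphic, rule lim.herglotz_holomorphic)
  have hol_G: "G j k holomorphic_on ball 0 1" for j k
    unfolding G_def by (intro holomorphic_intros hol_exp)
  have G_le_M: "cmod (G j k z) \<le> M j" if z: "cmod z < 1" for j k z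
  proof -
    have "cmod (exp (approx_exponent j z - limit_exponent z)) \<le> exp (2 ^ j)"
      using Re_approx_exponent_le[OF z, of j] lim.Re_herglotz_nonneg[OF z]
      by (simp add: limit_exponent_def)
    then have "cmod (exp (approx_exponent j z - limit_exponent z) - 1) \<le> M j"
      unfolding M_def by (intro order_trans[OF norm_triangle_ineq4]) simp
    moreover have "cmod (z ^ k) \<le> 1" using z by (simp add: norm_power power_le_one)
    ultimately show ?thesis
      unfolding G_def norm_mult by (metis mult_mono norm_ge_zero mult_1 zero_le_one)
  qed
  have G_le_e: "cmod (G j k z) \<le> e j" if z: "cmod z \<le> 1/2" for j k z
  proof -
    let ?w = "approx_exponent j z - limit_exponent z"
    have w: "cmod ?w \<le> 16 * pi / 2 ^ s j" by (rule exponents_close[OF z])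
    also have "\<dots> \<le> 16 * pi / 1" by (intro divide_left_mono) auto
    finally have w': "cmod ?w \<le> 16 * pi" by simp
    have "cmod (exp ?w - 1) \<le> exp (16 * pi) * (16 * pi / 2 ^ s j)"
      using w w' by (intro order_trans[OF norm_exp_diff_1] mult_mono) auto
    then have "cmod (exp ?w - 1) \<le> e j" by (simp add: e_def B_def)
    moreover have "cmod (z ^ k) \<le> 1" using z by (simp add: norm_power power_le_one)
    ultimately show ?thesis
      unfolding G_def norm_mult by (metis mult_mono norm_ge_zero mult_1 zero_le_one)
  qed
  have rate: "4 ^ N j * (e j)\<^sup>2 / lam 0 + (M j)\<^sup>2 / lam (N j) \<le> (B\<^sup>2 / lam 0) * (1/4) ^ j + 1 / Suc j" for j
  proof -
    have "N j + j \<le> s j"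
      using member_le_sum[of j "{..j}" N] by (simp add: s_def)
    then have "(2::real) ^ N j * 2 ^ j \<le> 2 ^ s j"
      by (simp flip: power_add)
    then have "2 ^ N j * e j \<le> B * (1/2) ^ j"
      by (simp add: e_def B_def power_divide field_simps)
    then have "(2 ^ N j * e j)\<^sup>2 \<le> (B * (1/2) ^ j)\<^sup>2"
      by (intro power_mono) (auto simp: e_def B_def)
    moreover have "(2 ^ N j * e j)\<^sup>2 = 4 ^ N j * (e j)\<^sup>2" "(B * (1/2) ^ j)\<^sup>2 = B\<^sup>2 * (1/4) ^ j"
      by (simp_all add: power2_eq_square mult_ac flip: power_mult_distrib)
    ultimately have "4 ^ N j * (e j)\<^sup>2 / lam 0 \<le> B\<^sup>2 * (1/4) ^ j / lam 0"
      using assms(1)[of 0] by (intro divide_right_mono) auto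
    moreover have "(M j)\<^sup>2 / lam (N j) \<le> 1 / Suc j"
      using N[of j] assms(1)[of "N j"] by (simp add: field_simps)
    ultimately show ?thesis by simp
  qed
  have rate_lim: "(\<lambda>j. (B\<^sup>2 / lam 0) * (1/4) ^ j + 1 / Suc j) \<longlonglongrightarrow> B\<^sup>2 / lam 0 * 0 + 0"
    using LIMSEQ_inverse_real_of_nat
    by (intro tendsto_intros LIMSEQ_power_zero) (simp_all add: inverse_eq_divide)
  have zero: "f = (\<lambda>_. 0)" if f: "f \<in> model_space \<theta>" "f \<in> weighted_hardy lam" for f
  proof (rule eq_zero_if_taylor_zero)
    show "f \<in> holomorphic_disk" using f(2) by (simp add: weighted_hardy_def)
    define a where "a = taylor_coeff f"
    define C where "C = (\<Sum>n. lam n * (cmod (a n))\<^sup>2)"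
    have sum_a: "summable (\<lambda>n. lam n * (cmod (a n))\<^sup>2)"
      using f(2) by (simp add: weighted_hardy_def a_def)
    then have C0: "0 \<le> C"
      unfolding C_def using assms(1) by (intro suminf_nonneg) (auto simp: less_imp_le)
    fix k
    have "(cmod (a k))\<^sup>2 \<le> C * ((B\<^sup>2 / lam 0) * (1/4) ^ j + 1 / Suc j)" for j
    proof -
      note pairing = pairing_bound[OF hol_G[of j k] G_le_M G_le_e assms(1,2) sum_a]
      \<comment> \<open>\<open>f\<close> is orthogonal to \<open>\<theta> * ?H\<close>, which on the disk equals \<open>z ^ k + G j k z\<close>.\<close>
      let ?H = "restrict_disk (\<lambda>z. z ^ k * exp (approx_exponent j z))"
      have "?H \<in> hardy"
      proof (rule bounded_holomorphic_in_hardy)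
        show "(\<lambda>z. z ^ k * exp (approx_exponent j z)) holomorphic_on ball 0 1"
          by (intro holomorphic_intros hol_exp)
        fix z :: complex assume z: "cmod z < 1"
        have "cmod (z ^ k) \<le> 1" using z by (simp add: norm_power power_le_one)
        moreover have "cmod (exp (approx_exponent j z)) \<le> exp (2 ^ j)"
          using Re_approx_exponent_le[OF z, of j] by simp
        ultimately show "cmod (z ^ k * exp (approx_exponent j z)) \<le> exp (2 ^ j)"
          unfolding norm_mult by (metis mult_mono norm_ge_zero mult_1 zero_le_one)
      qed
      then have "hardy_inner f (\<lambda>z. \<theta> z * ?H z) = 0"
        using f(1) unfolding model_space_def by blast
      moreover have "taylor_coeff (\<lambda>z. \<theta> z * ?H z) n = taylor_coeff (G j k) n + (if n = k then 1 else 0)" for n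
      proof -
        have "taylor_coeff (\<lambda>z. \<theta> z * ?H z) n = taylor_coeff (\<lambda>z. G j k z + z ^ k) n"
          by (rule taylor_cong)
            (simp add: \<theta>_def singular_inner_of_erased_measure restrict_disk_def G_def exp_diff exp_minus field_simps)
        also have "\<dots> = taylor_coeff (G j k) n + (if n = k then 1 else 0)"
          by (subst taylor_coeff_add) (auto intro!: hol_G holomorphic_intros simp: taylor_coeff_power)
        finally show ?thesis .
      qed
      ultimately have "(\<Sum>n. a n * cnj (taylor_coeff (G j k) n) + (if n = k then a n else 0)) = 0"
        by (simp add: hardy_inner_def a_def distrib_left if_distrib cong: if_cong)
      moreover have "(\<lambda>n. a n * cnj (taylor_coeff (G j k) n) + (if n = k then a n else 0))
          sums ((\<Sum>n. a n * cnj (taylor_coeff (G j k) n)) + a k)"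
        by (intro sums_add sums_single summable_sums pairing(1))
      ultimately have "(\<Sum>n. a n * cnj (taylor_coeff (G j k) n)) + a k = 0"
        by (simp add: sums_iff)
      then have "cmod (a k) = cmod (\<Sum>n. a n * cnj (taylor_coeff (G j k) n))"
        by (metis add_eq_0_iff norm_minus_cancel)
      then have "(cmod (a k))\<^sup>2 \<le> C * (4 ^ N j * (e j)\<^sup>2 / lam 0 + (M j)\<^sup>2 / lam (N j))"
        using pairing(2)[of "N j"] by (simp add: C_def)
      also have "\<dots> \<le> C * ((B\<^sup>2 / lam 0) * (1/4) ^ j + 1 / Suc j)"
        by (intro mult_left_mono rate C0)
      finally show ?thesis .
    qed
    then have "(cmod (a k))\<^sup>2 \<le> C * (B\<^sup>2 / lam 0 * 0 + 0)"
      by (intro LIMSEQ_le_const[OF tendsto_mult_left[OF rate_lim]]) auto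
    then show "taylor_coeff f k = 0" by (simp add: a_def)
  qed
  have "taylor_coeff (\<lambda>_. 0) n = 0" for n by (simp add: taylor_coeff_def)
  then have "(\<lambda>_. 0) \<in> model_space \<theta> \<inter> weighted_hardy lam"
    by (auto simp: model_space_def hardy_def weighted_hardy_def holomorphic_disk_def hardy_inner_def)
  then show ?thesis
    using zero singular_inner_function_erased unfolding \<theta>_def by (intro exI[of _ "singular_inner_of erased_measure"]) auto
qed

end
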